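(* Let $c\neq 0$ be a rational number and let $b=0$. Then the cubic polynomials $P(x)$ and $Q(d)$ (defined in the context) are reducible over $\mathbb{Q}$. Moreover, each of $P$ and $Q$ has three integer roots (counted with multiplicity), and these roots can be labelled $x_1,x_2,x_3$ (roots of $P$) and $d_1,d_2,d_3$ (roots of $Q$) so that the auxiliary equations hold; however, these six numbers are not all positive, so they do not provide a solution of the perfect cuboid problem (Problem 1.2).
   Context: Let $b,c$ be rational numbers. Put $\Delta=b^2c^4-6b^2c^3+13b^2c^2-12b^2c+4b^2+c^2$ and $N=(bc-1-b)(bc-c-2b)$, and assume $\Delta\,N\neq 0$, so that all the following rational numbers are defined (with $D=b^2c^2+2b^2-3b^2c+c-bc^2+2b$): $E_{11}=-\frac{b(c^2+2-4c)}{D}$, $E_{01}=-\frac{b(c^2+2-2c)}{D}$, $E_{10}=-\frac{b^2c^2+2b^2-3b^2c-c}{D}$; $E_{20}=\frac{b}{2}(bc^2-2c-2b)(2bc^2-c^2-6bc+2+4b)(bc-1-b)^{-2}(bc-c-2b)^{-2}$; $E_{02}=\frac12(28b^2c^2-16b^2c-2c^2-4b^2-b^2c^4+4b^3c^4-12b^3c^3+4bc^3+24b^3c-8bc-2b^4c^4+12b^4c^3-26b^4c^2-8b^2c^3+24b^4c-16b^3-8b^4)(bc-1-b)^{-2}(bc-c-2b)^{-2}$; $E_{21}=\frac{b}{2}(5c^6b-2c^6b^2+52c^5b^2-16c^5b-2c^7b^2+2b^4c^8+142b^4c^6-26b^4c^7-426b^4c^5-61b^3c^6+100b^3c^5+14c^7b^3-c^8b^3-20bc^2-8b^2c^2-16b^2c-128b^2c^4-200b^3c^3+244b^3c^2+32bc^3-112b^3c+768b^4c^4-852b^4c^3+568b^4c^2+104b^2c^3-208b^4c+8c^4-4c^3+16b^3+32b^4-2c^5)\,\Delta^{-1}(bc-1-b)^{-2}(bc-c-2b)^{-2}$;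 $E_{12}=(16b^6+32b^5-6c^5b^2+2c^5b-62b^5c^6+62b^6c^6-180b^6c^5+18b^5c^7-12b^6c^7-2b^5c^8+b^6c^8+248b^5c^2+248b^6c^2-96b^6c+321b^6c^4-180b^5c^3-144b^5c-360b^6c^3+b^4c^8+8b^4c^6-6b^4c^7+18b^4c^5+7b^3c^6+90b^5c^5-14b^3c^5-c^7b^3+17b^2c^4+28b^3c^3-28b^3c^2-4bc^3+8b^3c-57b^4c^4+36b^4c^3+32b^4c^2-12b^2c^3-48b^4c-c^4+16b^4)\,\Delta^{-1}(bc-1-b)^{-2}(bc-c-2b)^{-2}$; $E_{03}=\frac{b}{2}(b^2c^4-5b^2c^3+10b^2c^2-10b^2c+4b^2+2bc+2c^2-bc^3)(2b^2c^4-12b^2c^3+26b^2c^2-24b^2c+8b^2-c^4b+3bc^3-6bc+4b+c^3-2c^2+2c)\,\Delta^{-1}(bc-1-b)^{-2}(bc-c-2b)^{-2}$; $E_{30}=c\,b^2(1-c)(c-2)(bc^2-4bc+2+4b)(2bc^2-c^2-4bc+2b)\,\Delta^{-1}(bc-1-b)^{-2}(bc-c-2b)^{-2}$. Define $P(x)=x^3-E_{10}x^2+E_{20}x-E_{30}$ and $Q(d)=d^3-E_{01}d^2+E_{02}d-E_{03}$. For numbers $x_1,x_2,x_3,d_1,d_2,d_3$ the auxiliary equations are: $x_1x_2d_3+x_2x_3d_1+x_3x_1d_2=E_{21}$, $x_1d_2+d_1x_2+x_2d_3+d_2x_3+x_3d_1+d_3x_1=E_{11}$, $x_1d_2d_3+x_2d_3d_1+x_3d_1d_2=E_{12}$.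 Problem 1.2 (equivalent to finding a perfect cuboid) asks for rational $b,c$ such that $P$ and $Q$ have positive rational roots $x_1,x_2,x_3$ and $d_1,d_2,d_3$ satisfying the auxiliary equations. *)

theory Defs
  imports "HOL-Computational_Algebra.Computational_Algebra"
begin

definition Delta :: "rat \<Rightarrow> rat \<Rightarrow> rat" where
  "Delta b c =
   b^2 * c^4 - 6 * b^2 * c^3 + 13 * b^2 * c^2 - 12 * b^2 * c + 4 * b^2 + c^2"

definition N :: "rat \<Rightarrow> rat \<Rightarrow> rat" where
  "N b c =
   (b * c - 1 - b) * (b * c - c - 2 * b)"

definition D :: "rat \<Rightarrow> rat \<Rightarrow> rat" where
  "D b c =
   b^2 * c^2 + 2 * b^2 - 3 * b^2 * c + c - b * c^2 + 2 * b"

definition E11 :: "rat \<Rightarrow> rat \<Rightarrow> rat" where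
  "E11 b c =
   - (b * (c^2 + 2 - 4 * c)) / D b c"

definition E01 :: "rat \<Rightarrow> rat \<Rightarrow> rat" where
  "E01 b c =
   - (b * (c^2 + 2 - 2 * c)) / D b c"

definition E10 :: "rat \<Rightarrow> rat \<Rightarrow> rat" where
  "E10 b c =
   - (b^2 * c^2 + 2 * b^2 - 3 * b^2 * c - c) / D b c"

definition E20 :: "rat \<Rightarrow> rat \<Rightarrow> rat" where
  "E20 b c =
   b / 2 * (b * c^2 - 2 * c - 2 * b) * (2 * b * c^2 - c^2 - 6 * b * c + 2 + 4 * b) / ((b
      * c - 1 - b)^2 * (b * c - c - 2 * b)^2)"

definition E02 :: "rat \<Rightarrow> rat \<Rightarrow> rat" where
  "E02 b c =
   1 / 2 * (28 * b^2 * c^2 - 16 * b^2 * c - 2 * c^2 - 4 * b^2 - b^2 * c^4 + 4 * b^3 *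
      c^4 - 12 * b^3 * c^3 + 4 * b * c^3 + 24 * b^3 * c - 8 * b * c - 2 * b^4 * c^4 + 12
      * b^4 * c^3 - 26 * b^4 * c^2 - 8 * b^2 * c^3 + 24 * b^4 * c - 16 * b^3 - 8 * b^4)
      / ((b * c - 1 - b)^2 * (b * c - c - 2 * b)^2)"

definition E21 :: "rat \<Rightarrow> rat \<Rightarrow> rat" where
  "E21 b c =
   b / 2 * (5 * c^6 * b - 2 * c^6 * b^2 + 52 * c^5 * b^2 - 16 * c^5 * b - 2 * c^7 * b^2
      + 2 * b^4 * c^8 + 142 * b^4 * c^6 - 26 * b^4 * c^7 - 426 * b^4 * c^5 - 61 * b^3 *
      c^6 + 100 * b^3 * c^5 + 14 * c^7 * b^3 - c^8 * b^3 - 20 * b * c^2 - 8 * b^2 * c^2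
      - 16 * b^2 * c - 128 * b^2 * c^4 - 200 * b^3 * c^3 + 244 * b^3 * c^2 + 32 * b *
      c^3 - 112 * b^3 * c + 768 * b^4 * c^4 - 852 * b^4 * c^3 + 568 * b^4 * c^2 + 104 *
      b^2 * c^3 - 208 * b^4 * c + 8 * c^4 - 4 * c^3 + 16 * b^3 + 32 * b^4 - 2 * c^5) /
      (Delta b c * (b * c - 1 - b)^2 * (b * c - c - 2 * b)^2)"

definition E12 :: "rat \<Rightarrow> rat \<Rightarrow> rat" where
  "E12 b c =
   (16 * b^6 + 32 * b^5 - 6 * c^5 * b^2 + 2 * c^5 * b - 62 * b^5 * c^6 + 62 * b^6 * c^6
      - 180 * b^6 * c^5 + 18 * b^5 * c^7 - 12 * b^6 * c^7 - 2 * b^5 * c^8 + b^6 * c^8 +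
      248 * b^5 * c^2 + 248 * b^6 * c^2 - 96 * b^6 * c + 321 * b^6 * c^4 - 180 * b^5 *
      c^3 - 144 * b^5 * c - 360 * b^6 * c^3 + b^4 * c^8 + 8 * b^4 * c^6 - 6 * b^4 * c^7
      + 18 * b^4 * c^5 + 7 * b^3 * c^6 + 90 * b^5 * c^5 - 14 * b^3 * c^5 - c^7 * b^3 +
      17 * b^2 * c^4 + 28 * b^3 * c^3 - 28 * b^3 * c^2 - 4 * b * c^3 + 8 * b^3 * c - 57
      * b^4 * c^4 + 36 * b^4 * c^3 + 32 * b^4 * c^2 - 12 * b^2 * c^3 - 48 * b^4 * c -
      c^4 + 16 * b^4) / (Delta b c * (b * c - 1 - b)^2 * (b * c - c - 2 * b)^2)"

definition E03 :: "rat \<Rightarrow> rat \<Rightarrow> rat" where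
  "E03 b c =
   b / 2 * (b^2 * c^4 - 5 * b^2 * c^3 + 10 * b^2 * c^2 - 10 * b^2 * c + 4 * b^2 + 2 * b
      * c + 2 * c^2 - b * c^3) * (2 * b^2 * c^4 - 12 * b^2 * c^3 + 26 * b^2 * c^2 - 24 *
      b^2 * c + 8 * b^2 - c^4 * b + 3 * b * c^3 - 6 * b * c + 4 * b + c^3 - 2 * c^2 + 2
      * c) / (Delta b c * (b * c - 1 - b)^2 * (b * c - c - 2 * b)^2)"

definition E30 :: "rat \<Rightarrow> rat \<Rightarrow> rat" where
  "E30 b c =
   c * b^2 * (1 - c) * (c - 2) * (b * c^2 - 4 * b * c + 2 + 4 * b) * (2 * b * c^2 - c^2
      - 4 * b * c + 2 * b) / (Delta b c * (b * c - 1 - b)^2 * (b * c - c - 2 * b)^2)"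

text \<open>
  The coefficients are well defined wherever Delta and N do not vanish: the third
  denominator D coincides with N.  In particular no division by zero occurs for
  nonzero c and b = 0.
\<close>

lemma D_eq_N: "D b c = N b c"
  by (simp add: D_def N_def algebra_simps power2_eq_square)

lemma nondegenerate_b0: "c \<noteq> 0 \<Longrightarrow> Delta 0 c * N 0 c \<noteq> 0"
  by (simp add: Delta_def N_def)

definition P :: "rat \<Rightarrow> rat \<Rightarrow> rat poly" where
  "P b c = [:- E30 b c, E20 b c, - E10 b c, 1:]"

definition Q :: "rat \<Rightarrow> rat \<Rightarrow> rat poly" where
  "Q b c = [:- E03 b c, E02 b c, - E01 b c, 1:]"

definition auxiliary_equations ::
  "rat \<Rightarrow> rat \<Rightarrow> rat \<Rightarrow> rat \<Rightarrow> rat \<Rightarrow> rat \<Rightarrow> rat \<Rightarrow> rat \<Rightarrow> bool" where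
  "auxiliary_equations b c x1 x2 x3 d1 d2 d3 \<longleftrightarrow>
     x1 * x2 * d3 + x2 * x3 * d1 + x3 * x1 * d2 = E21 b c \<and>
     x1 * d2 + d1 * x2 + x2 * d3 + d2 * x3 + x3 * d1 + d3 * x1 = E11 b c \<and>
     x1 * d2 * d3 + x2 * d3 * d1 + x3 * d1 * d2 = E12 b c"

definition all_positive ::
  "rat \<Rightarrow> rat \<Rightarrow> rat \<Rightarrow> rat \<Rightarrow> rat \<Rightarrow> rat \<Rightarrow> bool" where
  "all_positive x1 x2 x3 d1 d2 d3 \<longleftrightarrow>
     0 < x1 \<and> 0 < x2 \<and> 0 < x3 \<and> 0 < d1 \<and> 0 < d2 \<and> 0 < d3"

text \<open>
  Solutions of the perfect cuboid problem.  The x's and d's are all the roots of the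
  respective cubic, so multiplicities are taken into account through the multiset
  of roots.
\<close>

definition cuboid_problem_solution ::
  "rat \<Rightarrow> rat \<Rightarrow> rat \<Rightarrow> rat \<Rightarrow> rat \<Rightarrow> rat \<Rightarrow> rat \<Rightarrow> rat \<Rightarrow> bool" where
  "cuboid_problem_solution b c x1 x2 x3 d1 d2 d3 \<longleftrightarrow>
     Delta b c * N b c \<noteq> 0 \<and>
     proots (P b c) = {#x1, x2, x3#} \<and> proots (Q b c) = {#d1, d2, d3#} \<and>
     all_positive x1 x2 x3 d1 d2 d3 \<and>
     auxiliary_equations b c x1 x2 x3 d1 d2 d3"

end

theory Submission
  imports Defs
begin

text \<open>At \<open>b = 0\<close> nearly every term vanishes: \<open>D\<close> becomes
  \<open>c\<close> and \<open>Delta\<close> becomes \<open>c^2\<close>, so \<open>P\<close>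
  collapses to \<open>x^2 (x - 1)\<close> and \<open>Q\<close> to \<open>d (d - 1) (d + 1)\<close>,
  independently of \<open>c\<close> (\<open>P_b0\<close>, \<open>Q_b0\<close>). The roots can be
  read off, and the zeros among them rule out positivity.\<close>

lemma proots_three_linear_factors:
  fixes x y z :: "'a :: idom"
  shows "proots ([:- x, 1:] * [:- y, 1:] * [:- z, 1:]) = {#x, y, z#}"
  \<comment> \<open>The deleted rules would expand the product and hide its factors from
    \<open>proots_mult\<close>.\<close>
  by (simp add: proots_mult del: mult_pCons_left mult_pCons_right)

text \<open>Units of a polynomial ring over a domain are constant, so neither cofactor of the
  product is a unit.\<close>

lemma not_irreducible_three_linear_factors:
  fixes x y z :: "'a :: idom"
  shows "\<not> irreducible ([:- x, 1:] * [:- y, 1:] * [:- z, 1:])"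
proof
  have nonunit: "\<not> [:- a, 1:] dvd 1" for a :: 'a
    by (simp add: is_unit_poly_iff)
  assume "irreducible ([:- x, 1:] * [:- y, 1:] * [:- z, 1:])"
  then have "[:- x, 1:] * [:- y, 1:] dvd 1 \<or> [:- z, 1:] dvd 1"
    by (rule irreducibleD) (rule refl)
  then show False
    using nonunit dvd_mult_left by blast
qed

text \<open>The factors \<open>[:- 0, 1:]\<close> are left unsimplified to match the generic lemmas
  on three linear factors.\<close>

lemma P_b0: "c \<noteq> 0 \<Longrightarrow> P 0 c = [:- 1, 1:] * [:- 0, 1:] * [:- 0, 1:]"
  by (simp add: P_def E10_def E20_def E30_def D_def)

lemma Q_b0: "c \<noteq> 0 \<Longrightarrow> Q 0 c = [:- 0, 1:] * [:- 1, 1:] * [:- (- 1), 1:]"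
  by (simp add: Q_def E01_def E02_def E03_def D_def)

text \<open>Here \<open>E21\<close> and \<open>E11\<close> are 0 and \<open>E12\<close> is -1. With
  x-roots 1, 0, 0 the last equation reads \<open>d2 * d3 = - 1\<close>, so the root 0 of
  \<open>Q\<close> must be paired with the root 1 of \<open>P\<close>.\<close>

lemma auxiliary_equations_b0: "c \<noteq> 0 \<Longrightarrow> auxiliary_equations 0 c 1 0 0 0 1 (- 1)"
  by (simp add: auxiliary_equations_def E21_def E11_def E12_def D_def Delta_def
      \<comment> \<open>Merges the denominator \<open>c^2 * c^2\<close> of \<open>E12\<close> into
        \<open>c^4\<close>, which cancels the numerator.\<close>
      flip: power_add)

theorem theorem2p1:
  fixes b c :: rat
  assumes "c \<noteq> 0" and "b = 0"
  shows "\<not> irreducible (P b c) \<and> \<not> irreducible (Q b c) \<and>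
    (\<exists>x1 x2 x3 d1 d2 d3.
       proots (P b c) = {#x1, x2, x3#} \<and> proots (Q b c) = {#d1, d2, d3#} \<and>
       {x1, x2, x3, d1, d2, d3} \<subseteq> \<int> \<and>
       auxiliary_equations b c x1 x2 x3 d1 d2 d3 \<and>
       \<not> all_positive x1 x2 x3 d1 d2 d3 \<and>
       \<not> cuboid_problem_solution b c x1 x2 x3 d1 d2 d3)"
proof (intro conjI exI)
  show "\<not> irreducible (P b c)" "\<not> irreducible (Q b c)"
    unfolding \<open>b = 0\<close> P_b0[OF \<open>c \<noteq> 0\<close>] Q_b0[OF \<open>c \<noteq> 0\<close>]
    by (rule not_irreducible_three_linear_factors)+
  show "proots (P b c) = {#1, 0, 0#}" "proots (Q b c) = {#0, 1, - 1#}"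
    unfolding \<open>b = 0\<close> P_b0[OF \<open>c \<noteq> 0\<close>] Q_b0[OF \<open>c \<noteq> 0\<close>]
    by (rule proots_three_linear_factors)+
  show "{1, 0, 0, 0, 1, - 1 :: rat} \<subseteq> \<int>"
    by simp
  show "auxiliary_equations b c 1 0 0 0 1 (- 1)"
    using assms auxiliary_equations_b0 by simp
  show "\<not> all_positive 1 0 0 0 1 (- 1)"
    by (simp add: all_positive_def)
  then show "\<not> cuboid_problem_solution b c 1 0 0 0 1 (- 1)"
    by (simp add: cuboid_problem_solution_def)
qed

end
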